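(* Let $\mathbb K$ be a field of characteristic different from $2$, let $n>3$, and let $a(y)=\sum_{j=3}^n a_jy^j\in\mathbb K[y]$ with $a_n\neq0$. Let $b(y)=\sum_{j=3}^n a_jy^{j-1}$, and let $$A=\mathbb K\langle x,y\rangle/I,$$ where $I$ is the two-sided ideal generated by $xy+yx+y^2$ and $xy+yx+x^2+b(y)$. Let $B=A/\mathrm{Id}(xy-yx)$ be the abelianization of $A$. Put $c(y)=\frac12(b(y)-b(-y))$ and $d(y)=\frac12(b(y)+b(-y))$, the odd and even parts of $b$. Then: (1) $A$ is infinite dimensional if and only if $c=0$ (that is, if and only if $a$ is odd). (2) If $c\ne0$ and $m=\deg c<n-1=\deg b$, then $\dim A=n+2m-1$. (3) If $c\neq 0$ and $\deg c=\deg b$, then $\dim A=3n-3$. (4) In any case in which $A$ is finite dimensional (i.e. $c\ne 0$), $\dim A-\dim B$ is a multiple of $4$.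
   Context: $\mathbb K\langle x,y\rangle$ is the free associative unital algebra on $x,y$; dimensions are over $\mathbb K$; $\mathrm{Id}(\cdot)$ is the two-sided ideal generated by the given element. The algebra $A$ is the potential algebra of the cyclicly invariant polynomial $F=x^2y+xyx+yx^2+xy^2+yxy+y^2x+a(y)$, i.e. its two relations are $\partial_xF$ and $\partial_yF$, where $\partial_x$, $\partial_y$ are the linear maps sending a monomial $w$ to $u$ if $w=xu$ (respectively $w=yu$) and to $0$ otherwise. *)

theory Defs
  imports
    "HOL-Library.Poly_Mapping"
    "HOL-Computational_Algebra.Polynomial"
    "HOL-Algebra.QuotRing"
    "HOL-Algebra.Embedded_Algebras"
    "HOL-Algebra.Algebraic_Closure_Type"
begin

datatype letter = LX | LY

datatype word = Word (letters: "letter list")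

text \<open>
  Words form the free monoid on two letters, written additively because \<open>Poly_Mapping\<close> takes its
  convolution product over an additive (here non-commutative) monoid of exponents.
  Hence \<open>word \<Rightarrow>\<^sub>0 'k\<close> is the monoid algebra of the free monoid, i.e. the free
  associative unital algebra on two generators.
\<close>

instantiation word :: monoid_add
begin

definition zero_word :: word
  where "zero_word = Word []"

definition plus_word :: "word \<Rightarrow> word \<Rightarrow> word"
  where "plus_word u v = Word (letters u @ letters v)"

instance
  by standard (simp_all add: zero_word_def plus_word_def)

end

type_synonym 'k free_alg = "word \<Rightarrow>\<^sub>0 'k"

definition scalar :: "'k::field \<Rightarrow> 'k free_alg"
  where "scalar k = Poly_Mapping.single 0 k"

definition gen_x :: "'k::field free_alg"
  where "gen_x = Poly_Mapping.single (Word [LX]) 1"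

definition gen_y :: "'k::field free_alg"
  where "gen_y = Poly_Mapping.single (Word [LY]) 1"

definition poly_at :: "'k::field poly \<Rightarrow> 'k free_alg \<Rightarrow> 'k free_alg"
  where "poly_at p u = (\<Sum>i\<le>Polynomial.degree p. scalar (Polynomial.coeff p i) * u ^ i)"

definition free_ring :: "'k::field free_alg ring"
  where "free_ring = ring_of_type_algebra"

definition ideal_I :: "'k::field poly \<Rightarrow> 'k free_alg set"
  where "ideal_I b = Idl\<^bsub>free_ring\<^esub>
    {gen_x * gen_y + gen_y * gen_x + gen_y ^ 2,
     gen_x * gen_y + gen_y * gen_x + gen_x ^ 2 + poly_at b gen_y}"

definition alg_A :: "'k::field poly \<Rightarrow> 'k free_alg set ring"
  where "alg_A b = free_ring Quot ideal_I b"

definition proj_A :: "'k::field poly \<Rightarrow> 'k free_alg \<Rightarrow> 'k free_alg set"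
  where "proj_A b f = ideal_I b +>\<^bsub>free_ring\<^esub> f"

definition commutator_ideal :: "'k::field poly \<Rightarrow> 'k free_alg set set"
  where "commutator_ideal b = Idl\<^bsub>alg_A b\<^esub>
    {proj_A b (gen_x * gen_y - gen_y * gen_x)}"

definition alg_B :: "'k::field poly \<Rightarrow> 'k free_alg set set ring"
  where "alg_B b = alg_A b Quot commutator_ideal b"

definition proj_B :: "'k::field poly \<Rightarrow> 'k free_alg set \<Rightarrow> 'k free_alg set set"
  where "proj_B b u = commutator_ideal b +>\<^bsub>alg_A b\<^esub> u"

text \<open>
  The library's dimension is taken over a subset of the ring itself, so the ground field enters
  through its image in the algebra, which acts by multiplication exactly as the ground field does.
\<close>

definition scalars_A :: "'k::field poly \<Rightarrow> 'k free_alg set set"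
  where "scalars_A b = range (\<lambda>k. proj_A b (scalar k))"

definition scalars_B :: "'k::field poly \<Rightarrow> 'k free_alg set set set"
  where "scalars_B b = range (\<lambda>k. proj_B b (proj_A b (scalar k)))"

abbreviation finite_dim_A :: "'k::field poly \<Rightarrow> bool"
  where "finite_dim_A b \<equiv> ring.finite_dimension (alg_A b) (scalars_A b) (carrier (alg_A b))"

abbreviation finite_dim_B :: "'k::field poly \<Rightarrow> bool"
  where "finite_dim_B b \<equiv> ring.finite_dimension (alg_B b) (scalars_B b) (carrier (alg_B b))"

text \<open>The following two numbers are meaningful only in the finite dimensional case.\<close>

abbreviation dim_A :: "'k::field poly \<Rightarrow> nat"
  where "dim_A b \<equiv> ring.dim (alg_A b) (scalars_A b) (carrier (alg_A b))"

abbreviation dim_B :: "'k::field poly \<Rightarrow> nat"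
  where "dim_B b \<equiv> ring.dim (alg_B b) (scalars_B b) (carrier (alg_B b))"

end

theory Submission
  imports Defs "HOL-Library.Product_Plus"
begin

text \<open>
  Since \<open>2\<close> is invertible, \<open>u = 2x + y\<close> may replace \<open>x\<close> as a generator. In terms of \<open>u\<close> and \<open>y\<close>
  the two relations become \<open>uy + yu = 0\<close> and \<open>u\<^sup>2 = e(y)\<close> with \<open>e = 3y\<^sup>2 - 4b\<close>. Every element
  therefore reduces to the shape \<open>p(y) + q(y)u\<close>, and the only question is which of these
  normal forms vanish. Computing \<open>u\<^sup>3\<close> in two ways gives \<open>(e(-y) - e(y))u = 0\<close>, that is
  \<open>c(y)u = 0\<close>, and multiplying by \<open>u\<close> on the right gives \<open>c(y)e(y) = 0\<close>.
  In the abelianization \<open>uy = -yu\<close> and \<open>uy = yu\<close>, hence \<open>yu = 0\<close> and \<open>y e(y) = 0\<close>; since \<open>y\<close>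
  divides the odd polynomial \<open>c\<close>, this subsumes the relations coming from \<open>c\<close>.

  Both algebras are thus instances of one situation: \<open>Q(y)u = 0\<close> with \<open>Q = c\<close> or \<open>Q = y\<close>, and
  the claim is that \<open>p(y) + q(y)u\<close> vanishes only if \<open>Qe\<close> divides \<open>p\<close> and \<open>Q\<close> divides \<open>q\<close>. To see
  this, let the free algebra act on pairs \<open>(p, q)\<close>, thought of as \<open>p + qu\<close>: \<open>y\<close> multiplies, and
  \<open>u(p, q) = (q(-y)e(y), p(-y))\<close>. The pairs with \<open>Qe\<close> dividing \<open>p\<close> and \<open>Q\<close> dividing \<open>q\<close> form a
  submodule (\<open>act_submodule\<close>), and the defining relations map every pair into it. So every
  element of the ideal does, and applying \<open>p(y) + q(y)u\<close> to \<open>(1, 0)\<close> recovers \<open>(p, q)\<close>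
  (\<open>normal_form_mem_iff\<close>).

  Consequently the quotient has dimension \<open>deg(Qe) + deg Q = 2 deg Q + deg e\<close> if \<open>Q\<close> is nonzero,
  and is infinite dimensional if \<open>Q = 0\<close>. With \<open>deg e = n - 1\<close> this is \<open>2 deg c + n - 1\<close> for \<open>A\<close> and
  \<open>n + 1\<close> for \<open>B\<close>. The difference \<open>2(deg c - 1)\<close> is a multiple of \<open>4\<close> because \<open>c\<close> is odd, so that
  its degree is odd.
\<close>

section \<open>Polynomials in the free algebra\<close>

lemma free_alg_induct [case_names single add]:
  fixes f :: "'k::field free_alg"
  assumes "\<And>w k. P (Poly_Mapping.single w k)" and "\<And>f g. P f \<Longrightarrow> P g \<Longrightarrow> P (f + g)"
  shows "P f"
proof -
  have zero: "P 0"
    using assms(1)[of 0 0] by simp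
  show ?thesis
  proof (induction f rule: update_induct)
    case const
    then show ?case using zero by (simp add: zero_poly_mapping.abs_eq[symmetric])
  next
    case (update f w k)
    have "Poly_Mapping.update w k f = f + Poly_Mapping.single w k"
      using update(1)
      by (intro poly_mapping_eqI)
        (auto simp: update.rep_eq lookup_add lookup_single in_keys_iff when_def)
    then show ?case using assms update by simp
  qed
qed

lemma scalar_simps [simp]: "scalar 0 = 0" "scalar 1 = 1"
  "scalar (j + k) = scalar j + scalar k" "scalar (j - k) = scalar j - scalar k"
  "scalar (- k) = - scalar k" "scalar (numeral n) = numeral n"
  by (simp_all add: scalar_def single_add single_diff single_uminus)

lemma scalar_mult: "scalar (j * k) = scalar j * scalar k"
  by (simp add: scalar_def mult_single)

lemma scalar_commute: "scalar k * f = f * scalar k"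
  by (induction f rule: free_alg_induct)
    (simp_all add: scalar_def mult_single mult.commute distrib_left distrib_right)

abbreviation at_y :: "'k::field poly \<Rightarrow> 'k free_alg"
  where "at_y p \<equiv> poly_at p gen_y"

lemma poly_at_eq_sum:
  assumes "Polynomial.degree p \<le> N"
  shows "poly_at p v = (\<Sum>i\<le>N. scalar (Polynomial.coeff p i) * v ^ i)"
  unfolding poly_at_def using assms
  by (intro sum.mono_neutral_left) (auto simp: coeff_eq_0)

lemma poly_at_0 [simp]: "poly_at 0 v = 0"
  by (simp add: poly_at_def)

lemma poly_at_add: "poly_at (p + q) v = poly_at p v + poly_at q v"
proof -
  let ?N = "max (Polynomial.degree p) (Polynomial.degree q)"
  show ?thesis
    using degree_add_le_max[of p q]
    by (simp add: poly_at_eq_sum[where N = ?N] sum.distrib distrib_right)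
qed

lemma poly_at_smult: "poly_at (Polynomial.smult k p) v = scalar k * poly_at p v"
  by (simp add: poly_at_eq_sum[where N = "Polynomial.degree p"] sum_distrib_left scalar_mult mult.assoc)

lemma poly_at_pCons: "poly_at (pCons k p) v = scalar k + v * poly_at p v"
proof -
  have "poly_at (pCons k p) v
      = (\<Sum>i\<le>Suc (Polynomial.degree p). scalar (Polynomial.coeff (pCons k p) i) * v ^ i)"
    by (rule poly_at_eq_sum) (simp add: degree_pCons_le)
  also have "\<dots> = scalar k + (\<Sum>i\<le>Polynomial.degree p. v * (scalar (Polynomial.coeff p i) * v ^ i))"
    by (simp add: sum.atMost_Suc_shift scalar_commute[of _ v] flip: mult.assoc del: sum.atMost_Suc)
  finally show ?thesis
    by (simp add: poly_at_def sum_distrib_left)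
qed

lemma poly_at_mult: "poly_at (p * q) v = poly_at p v * poly_at q v"
  by (induction p)
    (simp_all add: poly_at_add poly_at_smult poly_at_pCons distrib_right mult.assoc)

lemma poly_at_minus: "poly_at (- p) v = - poly_at p v"
  using poly_at_smult[of "-1" p v] by simp

lemma poly_at_diff: "poly_at (p - q) v = poly_at p v - poly_at q v"
  using poly_at_add[of p "- q" v] by (simp add: poly_at_minus)

lemma poly_at_monom: "poly_at (Polynomial.monom k i) v = scalar k * v ^ i"
  by (induction i) (simp_all add: monom_0 monom_Suc poly_at_pCons flip: mult.assoc scalar_commute)

lemma poly_at_sum: "poly_at (\<Sum>i\<in>A. p i) v = (\<Sum>i\<in>A. poly_at (p i) v)"
  by (induction A rule: infinite_finite_induct) (simp_all add: poly_at_add)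

lemma at_y_gen: "at_y [:0, 1:] = gen_y"
  by (simp add: poly_at_pCons)

abbreviation refl_poly :: "'k::field poly \<Rightarrow> 'k poly"
  where "refl_poly p \<equiv> pcompose p [:0, -1:]"

lemma refl_refl [simp]: "refl_poly (refl_poly p) = p"
  by (simp add: pcompose_pCons flip: pcompose_assoc)

lemma refl_simps:
  "refl_poly (p + q) = refl_poly p + refl_poly q"
  "refl_poly (p * q) = refl_poly p * refl_poly q"
  "refl_poly (pCons 0 p) = - pCons 0 (refl_poly p)"
  "refl_poly (Polynomial.smult k p) = Polynomial.smult k (refl_poly p)"
  "refl_poly (- p) = - refl_poly p"
  "refl_poly (p - q) = refl_poly p - refl_poly q"
  by (simp_all add: pcompose_add pcompose_mult pcompose_pCons pcompose_smult pcompose_uminus pcompose_diff)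

definition gen_u :: "'k::field free_alg"
  where "gen_u = 2 * gen_x + gen_y"

lemma gen_x_eq:
  assumes "(2::'k::field) \<noteq> 0"
  shows "(gen_x :: 'k free_alg) = scalar (1/2) * (gen_u - gen_y)"
proof -
  have "scalar (1/2) * (2 :: 'k free_alg) = scalar (1/2 * 2)"
    unfolding scalar_mult by simp
  also have "\<dots> = 1" using assms by simp
  finally show ?thesis by (simp add: gen_u_def flip: mult.assoc)
qed

section \<open>Two-sided ideals of the free algebra\<close>

lemma ring_free_ring: "ring (free_ring :: 'k::field free_alg ring)"
proof -
  have "\<exists>y. x + y = 0" for x :: "'k free_alg"
    by (rule exI[of _ "- x"]) simp
  moreover have "\<exists>y. y + x = 0" for x :: "'k free_alg"
    by (rule exI[of _ "- x"]) simp
  ultimately show ?thesis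
    unfolding free_ring_def ring_of_type_algebra_def
    by unfold_locales (auto simp: algebra_simps Units_def)
qed

lemma free_ring_simps [simp]:
  "carrier free_ring = UNIV"
  "f \<otimes>\<^bsub>free_ring\<^esub> g = f * g"
  "f \<oplus>\<^bsub>free_ring\<^esub> g = f + g"
  "\<one>\<^bsub>free_ring\<^esub> = 1"
  "\<zero>\<^bsub>free_ring\<^esub> = 0"
  by (simp_all add: free_ring_def ring_of_type_algebra_def)

lemma ideal_free_ringI:
  fixes J :: "'k::field free_alg set"
  assumes "0 \<in> J" "\<And>f g. f \<in> J \<Longrightarrow> g \<in> J \<Longrightarrow> f + g \<in> J"
    and "\<And>f g. g \<in> J \<Longrightarrow> f * g \<in> J" "\<And>f g. g \<in> J \<Longrightarrow> g * f \<in> J"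
  shows "ideal J free_ring"
proof (rule idealI)
  interpret ring "free_ring :: 'k free_alg ring" by (rule ring_free_ring)
  have minus: "- f \<in> J" if "f \<in> J" for f
    using assms(3)[of f "- 1"] that by simp
  show "subgroup J (add_monoid free_ring)"
  proof (rule add.subgroupI)
    fix f assume f: "f \<in> J"
    have "\<ominus>\<^bsub>free_ring\<^esub> f = - f"
      using minus_equality[of "- f" f] by simp
    then show "\<ominus>\<^bsub>free_ring\<^esub> f \<in> J" using minus f by simp
  qed (use assms in auto)
qed (use assms ring_free_ring in auto)

locale free_ideal =
  fixes J :: "'k::field free_alg set"
  assumes ideal_J: "ideal J free_ring"
begin

lemma zero: "0 \<in> J"
  using ideal_J additive_subgroup.zero_closed ideal.axioms(1) by fastforce

lemma add: "f \<in> J \<Longrightarrow> g \<in> J \<Longrightarrow> f + g \<in> J"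
  using ideal_J additive_subgroup.a_closed ideal.axioms(1) by fastforce

lemma mult_left: "g \<in> J \<Longrightarrow> f * g \<in> J"
  using ideal.I_l_closed[OF ideal_J, of g f] by simp

lemma mult_right: "g \<in> J \<Longrightarrow> g * f \<in> J"
  using ideal.I_r_closed[OF ideal_J, of g f] by simp

lemma minus: "f \<in> J \<Longrightarrow> - f \<in> J"
  using mult_left[of f "- 1"] by simp

lemma diff: "f \<in> J \<Longrightarrow> g \<in> J \<Longrightarrow> f - g \<in> J"
  using add[of f "- g"] minus[of g] by simp

definition eqv :: "'k free_alg \<Rightarrow> 'k free_alg \<Rightarrow> bool"  (infix "\<approx>" 50)
  where "f \<approx> g \<longleftrightarrow> f - g \<in> J"

lemma eqv_refl [simp]: "f \<approx> f"
  by (simp add: eqv_def zero)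

lemma eqv_sym: "f \<approx> g \<Longrightarrow> g \<approx> f"
  using minus[of "f - g"] by (simp add: eqv_def)

lemma eqv_trans [trans]: "f \<approx> g \<Longrightarrow> g \<approx> h \<Longrightarrow> f \<approx> h"
  using add[of "f - g" "g - h"] by (simp add: eqv_def)

lemma eqv_add: "f \<approx> g \<Longrightarrow> f' \<approx> g' \<Longrightarrow> f + f' \<approx> g + g'"
  using add[of "f - g" "f' - g'"] by (simp add: eqv_def algebra_simps)

lemma eqv_left: "f \<approx> g \<Longrightarrow> h * f \<approx> h * g"
  using mult_left[of "f - g" h] by (simp add: eqv_def algebra_simps)

lemma eqv_right: "f \<approx> g \<Longrightarrow> f * h \<approx> g * h"
  using mult_right[of "f - g" h] by (simp add: eqv_def algebra_simps)

lemma eqv_zero_iff: "f \<approx> 0 \<longleftrightarrow> f \<in> J"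
  by (simp add: eqv_def)

lemma eqv_mem: "f \<approx> g \<Longrightarrow> f \<in> J \<longleftrightarrow> g \<in> J"
  using eqv_trans eqv_sym eqv_zero_iff by blast

end

section \<open>Reduction to normal form\<close>

text \<open>
  Ideals modulo which \<open>u\<close> anticommutes with \<open>y\<close> and squares to a polynomial in \<open>y\<close>. Both the
  ideal defining \<open>A\<close> and the larger one defining the abelianization are of this kind.
\<close>

locale skew_ideal = free_ideal J for J :: "'k::field free_alg set" +
  fixes e :: "'k poly"
  assumes two: "(2::'k) \<noteq> 0"
    and anti: "gen_u * gen_y + gen_y * gen_u \<in> J"
    and square: "gen_u * gen_u - at_y e \<in> J"
begin

lemma gen_u_at_y: "gen_u * at_y p \<approx> at_y (refl_poly p) * gen_u"
proof (induction p)
  case 0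
  then show ?case by simp
next
  case (pCons k p)
  have uy: "gen_u * gen_y \<approx> - gen_y * gen_u"
    using anti by (simp add: eqv_def)
  have "gen_u * at_y (pCons k p) = scalar k * gen_u + (gen_u * gen_y) * at_y p"
    by (simp add: poly_at_pCons algebra_simps scalar_commute)
  also have "\<dots> \<approx> scalar k * gen_u + (- gen_y * gen_u) * at_y p"
    by (intro eqv_add eqv_right uy) simp
  also have "\<dots> = scalar k * gen_u + - gen_y * (gen_u * at_y p)"
    by (simp add: mult.assoc)
  also have "\<dots> \<approx> scalar k * gen_u + - gen_y * (at_y (refl_poly p) * gen_u)"
    by (intro eqv_add eqv_left pCons.IH) simp
  also have "\<dots> = at_y (refl_poly (pCons k p)) * gen_u"
    by (simp add: pcompose_pCons poly_at_add poly_at_pCons poly_at_minus algebra_simps)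
  finally show ?case .
qed

lemma gen_u_square: "gen_u * gen_u \<approx> at_y e"
  using square by (simp add: eqv_def)

text \<open>
  The associativity constraint behind the whole count: \<open>u\<^sup>3\<close> is both \<open>u e(y) = e(-y) u\<close> and
  \<open>e(y) u\<close>.
\<close>
lemma reflection_difference: "at_y (refl_poly e - e) * gen_u \<in> J"
proof -
  have "at_y (refl_poly e) * gen_u \<approx> gen_u * at_y e"
    using gen_u_at_y eqv_sym by blast
  also have "\<dots> \<approx> gen_u * (gen_u * gen_u)"
    using gen_u_square eqv_left eqv_sym by blast
  also have "\<dots> = (gen_u * gen_u) * gen_u"
    by (simp add: mult.assoc)
  also have "\<dots> \<approx> at_y e * gen_u"
    using gen_u_square eqv_right by blast
  finally show ?thesis
    by (simp add: eqv_def poly_at_diff algebra_simps)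
qed

lemma gen_u_normal_form:
  "gen_u * (at_y p + at_y q * gen_u) \<approx> at_y (refl_poly q * e) + at_y (refl_poly p) * gen_u"
proof -
  have "gen_u * (at_y p + at_y q * gen_u) = gen_u * at_y q * gen_u + gen_u * at_y p"
    by (simp add: algebra_simps)
  also have "\<dots> \<approx> at_y (refl_poly q) * gen_u * gen_u + at_y (refl_poly p) * gen_u"
    by (intro eqv_add eqv_right gen_u_at_y)
  also have "\<dots> = at_y (refl_poly q) * (gen_u * gen_u) + at_y (refl_poly p) * gen_u"
    by (simp add: mult.assoc)
  also have "\<dots> \<approx> at_y (refl_poly q) * at_y e + at_y (refl_poly p) * gen_u"
    by (intro eqv_add eqv_left gen_u_square) simp
  finally show ?thesis by (simp add: poly_at_mult)
qed

definition reducible :: "'k free_alg \<Rightarrow> bool"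
  where "reducible f \<longleftrightarrow> (\<exists>p q. f \<approx> at_y p + at_y q * gen_u)"

lemma reducible_add:
  assumes "reducible f" "reducible g"
  shows "reducible (f + g)"
proof -
  obtain p q p' q' where "f \<approx> at_y p + at_y q * gen_u" "g \<approx> at_y p' + at_y q' * gen_u"
    using assms unfolding reducible_def by blast
  then have "f + g \<approx> at_y (p + p') + at_y (q + q') * gen_u"
    using eqv_add by (fastforce simp: poly_at_add algebra_simps)
  then show ?thesis unfolding reducible_def by blast
qed

lemma reducible_poly_mult:
  assumes "reducible f"
  shows "reducible (at_y r * f)"
proof -
  obtain p q where "f \<approx> at_y p + at_y q * gen_u"
    using assms unfolding reducible_def by blast
  then have "at_y r * f \<approx> at_y (r * p) + at_y (r * q) * gen_u"
    using eqv_left[of f "at_y p + at_y q * gen_u" "at_y r"]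
    by (simp add: poly_at_mult distrib_left mult.assoc)
  then show ?thesis unfolding reducible_def by blast
qed

lemma reducible_gen_u:
  assumes "reducible f"
  shows "reducible (gen_u * f)"
  using assms gen_u_normal_form eqv_left eqv_trans unfolding reducible_def by meson

lemma reducible_gen_x:
  assumes "reducible f"
  shows "reducible (gen_x * f)"
proof -
  have "gen_x * f = at_y [:1/2:] * (gen_u * f) + at_y [:0, - (1/2):] * f"
    by (simp add: gen_x_eq[OF two] poly_at_pCons algebra_simps flip: scalar_commute)
  then show ?thesis
    using reducible_add reducible_poly_mult reducible_gen_u assms by metis
qed

text \<open>
  The reducible elements contain the constants and are closed under left multiplication by the
  generators, so an induction over the letters of a word reaches everything.
\<close>
lemma all_reducible: "reducible f"
proof (induction f rule: free_alg_induct)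
  case (single w k)
  have "reducible (Poly_Mapping.single (Word ls) k)" for ls
  proof (induction ls)
    case Nil
    have "Poly_Mapping.single (Word []) k = at_y [:k:] + at_y 0 * gen_u"
      by (simp add: poly_at_pCons scalar_def zero_word_def)
    then show ?case unfolding reducible_def by (metis eqv_refl)
  next
    case (Cons l ls)
    have "Poly_Mapping.single (Word (l # ls)) k
        = (case l of LX \<Rightarrow> gen_x | LY \<Rightarrow> gen_y) * Poly_Mapping.single (Word ls) k"
      by (simp add: gen_x_def gen_y_def mult_single plus_word_def split: letter.split)
    then show ?case
      using reducible_gen_x reducible_poly_mult[of _ "[:0, 1:]"] Cons
      by (cases l) (simp_all add: at_y_gen)
  qed
  then show ?case by (metis word.exhaust_sel)
next
  case (add f g)
  then show ?case by (rule reducible_add)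
qed

end

section \<open>An action on pairs of polynomials\<close>

definition scale_pair :: "'k::field \<Rightarrow> 'k poly \<times> 'k poly \<Rightarrow> 'k poly \<times> 'k poly"
  where "scale_pair k v = (Polynomial.smult k (fst v), Polynomial.smult k (snd v))"

text \<open>
  A pair \<open>(p, q)\<close> stands for \<open>p(y) + q(y)u\<close>. The clause for \<open>x\<close> is the action of \<open>(u - y)/2\<close>, where
  \<open>u(p, q) = (q(-y)e, p(-y))\<close> copies the reduction of \<open>u(p + qu)\<close>. No quotient is taken here:
  \<open>u\<^sup>2\<close> acts as \<open>e(y)\<close> only up to the submodule introduced below.
\<close>
definition act_letter :: "'k::field poly \<Rightarrow> letter \<Rightarrow> 'k poly \<times> 'k poly \<Rightarrow> 'k poly \<times> 'k poly"
  where "act_letter e l v = (case l of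
      LX \<Rightarrow> scale_pair (1/2) (refl_poly (snd v) * e - pCons 0 (fst v), refl_poly (fst v) - pCons 0 (snd v))
    | LY \<Rightarrow> (pCons 0 (fst v), pCons 0 (snd v)))"

definition act_word :: "'k::field poly \<Rightarrow> word \<Rightarrow> 'k poly \<times> 'k poly \<Rightarrow> 'k poly \<times> 'k poly"
  where "act_word e w v = foldr (act_letter e) (letters w) v"

definition act :: "'k::field poly \<Rightarrow> 'k free_alg \<Rightarrow> 'k poly \<times> 'k poly \<Rightarrow> 'k poly \<times> 'k poly"
  where "act e f v = (\<Sum>w\<in>Poly_Mapping.keys f. scale_pair (Poly_Mapping.lookup f w) (act_word e w v))"

lemma scale_pair_simps:
  "scale_pair k (v + w) = scale_pair k v + scale_pair k w"
  "scale_pair (j + k) v = scale_pair j v + scale_pair k v"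
  "scale_pair j (scale_pair k v) = scale_pair (j * k) v"
  "scale_pair 0 v = 0" "scale_pair 1 v = v" "scale_pair k 0 = 0"
  by (simp_all add: scale_pair_def smult_add_right smult_add_left plus_prod_def zero_prod_def)

lemma act_letter_linear:
  "act_letter e l (v + w) = act_letter e l v + act_letter e l w"
  "act_letter e l (scale_pair k v) = scale_pair k (act_letter e l v)"
  by (auto simp: act_letter_def scale_pair_def refl_simps plus_prod_def algebra_simps
      smult_add_right smult_diff_right split: letter.split)

lemma act_word_linear:
  "act_word e w (v + v') = act_word e w v + act_word e w v'"
  "act_word e w (scale_pair k v) = scale_pair k (act_word e w v)"
proof -
  have "foldr (act_letter e) ls (v + v') = foldr (act_letter e) ls v + foldr (act_letter e) ls v'"
    "foldr (act_letter e) ls (scale_pair k v) = scale_pair k (foldr (act_letter e) ls v)" for ls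
    by (induction ls) (simp_all add: act_letter_linear)
  then show "act_word e w (v + v') = act_word e w v + act_word e w v'"
    "act_word e w (scale_pair k v) = scale_pair k (act_word e w v)"
    by (simp_all add: act_word_def)
qed

lemma act_superset:
  assumes "finite S" "Poly_Mapping.keys f \<subseteq> S"
  shows "act e f v = (\<Sum>w\<in>S. scale_pair (Poly_Mapping.lookup f w) (act_word e w v))"
  unfolding act_def using assms
  by (intro sum.mono_neutral_left) (auto simp: in_keys_iff scale_pair_simps)

lemma act_add: "act e (f + g) v = act e f v + act e g v"
proof -
  let ?S = "Poly_Mapping.keys f \<union> Poly_Mapping.keys g"
  show ?thesis
    using keys_add[of f g]
    by (simp add: act_superset[where S = ?S] lookup_add scale_pair_simps sum.distrib)
qed

lemma act_single: "act e (Poly_Mapping.single w k) v = scale_pair k (act_word e w v)"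
  by (subst act_superset[where S = "{w}"]) simp_all

lemma act_zero [simp]: "act e 0 v = 0"
  by (simp add: act_def)

lemma act_linear:
  "act e f (v + v') = act e f v + act e f v'"
  "act e f (scale_pair k v) = scale_pair k (act e f v)"
  by (induction f rule: free_alg_induct)
    (simp_all add: act_add act_single act_word_linear scale_pair_simps mult.commute add_ac)

lemma act_mult: "act e (f * g) v = act e f (act e g v)"
proof (induction f rule: free_alg_induct)
  case (single w k)
  show ?case
  proof (induction g rule: free_alg_induct)
    case (single w' k')
    have "act_word e (w + w') v = act_word e w (act_word e w' v)"
      by (simp add: act_word_def plus_word_def)
    then show ?case
      by (simp add: mult_single act_single act_word_linear scale_pair_simps)
  next
    case (add g h)
    then show ?case by (simp add: distrib_left act_add act_linear)
  qed
next
  case (add f g)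
  then show ?case by (simp add: distrib_right act_add)
qed

lemma act_scalar [simp]: "act e (scalar k) v = scale_pair k v"
  by (simp add: scalar_def act_single act_word_def zero_word_def)

lemma act_minus: "act e (- f) v = - act e f v"
  using act_add[of e f "- f" v] by (simp add: eq_neg_iff_add_eq_0 add.commute)

lemma act_diff: "act e (f - g) v = act e f v - act e g v"
  using act_add[of e f "- g" v] by (simp add: act_minus)

lemma act_gen_y [simp]: "act e gen_y (p, q) = (pCons 0 p, pCons 0 q)"
  by (simp add: gen_y_def act_single act_word_def act_letter_def scale_pair_simps)

lemma act_gen_u [simp]:
  assumes "(2::'k::field) \<noteq> 0"
  shows "act e gen_u (p, q) = (refl_poly q * e, refl_poly p :: 'k poly)"
proof -
  have "act e gen_x (p, q)
      = scale_pair (1/2) (refl_poly q * e - pCons 0 p, refl_poly p - pCons 0 q)"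
    by (simp add: gen_x_def act_single act_word_def act_letter_def scale_pair_simps)
  moreover have "act e gen_u (p, q) = scale_pair 2 (act e gen_x (p, q)) + act e gen_y (p, q)"
  proof -
    have "act e gen_u (p, q) = act e (scalar 2 * gen_x + gen_y) (p, q)"
      by (simp add: gen_u_def)
    then show ?thesis by (simp only: act_add act_mult act_scalar)
  qed
  ultimately show ?thesis
    using assms by (simp add: scale_pair_simps)
qed

text \<open>
  In particular \<open>p(y) + q(y)u\<close> sends \<open>(1, 0)\<close> to \<open>(p, q)\<close>, so a normal form can be read off from its
  action.
\<close>
lemma act_at_y [simp]: "act e (at_y r) (p, q) = (r * p, r * q)"
  by (induction r)
    (simp_all add: poly_at_pCons act_add act_mult scale_pair_def plus_prod_def zero_prod_def)

definition submodule_pairs :: "'k::field poly \<Rightarrow> 'k poly \<Rightarrow> ('k poly \<times> 'k poly) set"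
  where "submodule_pairs e Q = {v. Q * e dvd fst v \<and> Q dvd snd v}"

definition annihilating :: "'k::field poly \<Rightarrow> 'k poly \<Rightarrow> 'k free_alg set"
  where "annihilating e Q = {f. \<forall>v. act e f v \<in> submodule_pairs e Q}"

text \<open>
  The first condition is stronger than the second by the factor \<open>e\<close>. This survives the exchange
  of components under \<open>u\<close> since the new first component carries a factor \<open>e\<close>.
\<close>
lemma act_submodule:
  fixes Q :: "'k::field poly"
  assumes Q: "Q dvd refl_poly Q" and v: "v \<in> submodule_pairs e Q"
  shows "act e f v \<in> submodule_pairs e Q"
proof (induction f rule: free_alg_induct)
  case (single w k)
  have refl: "Q dvd refl_poly r" if "Q dvd r" for r
    using that Q by (auto simp: refl_simps elim!: dvdE)
  have letter: "act_letter e l v \<in> submodule_pairs e Q" if "v \<in> submodule_pairs e Q" for l v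
  proof -
    have "Q * e dvd pCons 0 (fst v)" "Q dvd pCons 0 (snd v)"
      using that dvd_mult[of _ _ "[:0, 1:]"] by (force simp: submodule_pairs_def)+
    moreover have "Q dvd refl_poly (snd v)" "Q dvd refl_poly (fst v)"
      using that refl by (auto simp: submodule_pairs_def intro: dvd_mult_left)
    ultimately show ?thesis
      by (auto simp: act_letter_def submodule_pairs_def scale_pair_def
          intro!: dvd_smult dvd_diff mult_dvd_mono split: letter.split)
  qed
  have "foldr (act_letter e) ls v \<in> submodule_pairs e Q" for ls
    by (induction ls) (simp_all add: v letter)
  then show ?case
    by (simp add: act_single act_word_def) (auto simp: submodule_pairs_def scale_pair_def dvd_smult)
next
  case (add f g)
  then show ?case by (auto simp: act_add submodule_pairs_def)
qed

text \<open>
  Closure under multiplication on the left is invariance of the submodule, closure on the right is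
  automatic because all vectors are tested.
\<close>
lemma ideal_annihilating:
  fixes Q :: "'k::field poly"
  assumes Q: "Q dvd refl_poly Q"
  shows "ideal (annihilating e Q) free_ring"
proof (rule ideal_free_ringI)
  show "0 \<in> annihilating e Q"
    by (auto simp: annihilating_def submodule_pairs_def)
  show "f + g \<in> annihilating e Q" if "f \<in> annihilating e Q" "g \<in> annihilating e Q" for f g
    using that by (auto simp: annihilating_def act_add submodule_pairs_def)
  show "f * g \<in> annihilating e Q" if "g \<in> annihilating e Q" for f g
    using that act_submodule[OF Q] by (auto simp: annihilating_def act_mult)
  show "g * f \<in> annihilating e Q" if "g \<in> annihilating e Q" for f g
    using that unfolding annihilating_def mem_Collect_eq act_mult by blast
qed


section \<open>Dimension of the quotient\<close>

lemma coeff_sum_monom: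
  "Polynomial.coeff (\<Sum>i<M. Polynomial.monom (k i) i) j = (if j < M then k j else 0)"
  by (simp add: coeff_sum)

lemma dvd_sum_monom_zero:
  fixes R :: "'k::field poly"
  assumes "R dvd (\<Sum>i<M. Polynomial.monom (k i) i)" "R = 0 \<or> M \<le> Polynomial.degree R" "i < M"
  shows "k i = 0"
proof -
  let ?p = "\<Sum>i<M. Polynomial.monom (k i) i"
  have "?p = 0"
  proof (rule ccontr)
    assume p: "?p \<noteq> 0"
    then have "R \<noteq> 0" using assms(1) by auto
    moreover have "Polynomial.degree ?p < M"
    proof (rule ccontr)
      assume "\<not> Polynomial.degree ?p < M"
      then have "Polynomial.coeff ?p (Polynomial.degree ?p) = 0" by (simp only: coeff_sum_monom if_False)
      then show False using p by simp
    qed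
    ultimately show False
      using dvd_imp_degree_le[OF assms(1) p] assms(2) by simp
  qed
  then show ?thesis
    using coeff_sum_monom[of k M i] assms(3) by simp
qed

lemma exists_sum_monom:
  fixes R :: "'k::field poly"
  assumes "R \<noteq> 0"
  obtains k where "R dvd p - (\<Sum>i<Polynomial.degree R. Polynomial.monom (k i) i)"
proof -
  let ?r = "p mod R"
  have "Polynomial.coeff ?r i = 0" if "\<not> i < Polynomial.degree R" for i
    using degree_mod_less[OF assms, of p] that by (cases "?r = 0") (auto simp: coeff_eq_0)
  then have "?r = (\<Sum>i<Polynomial.degree R. Polynomial.monom (Polynomial.coeff ?r i) i)"
    by (intro poly_eqI) (simp add: coeff_sum_monom)
  moreover have "R dvd p - ?r" by (simp add: minus_mod_eq_mult_div)
  ultimately show ?thesis using that by metis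
qed

lemma scalar_hom:
  assumes "ring_hom_ring (free_ring :: 'k::field free_alg ring) S \<pi>"
  shows "ring_hom_ring (ring_of_type_algebra :: 'k ring) S (\<pi> \<circ> scalar)"
proof (rule ring_hom_ringI2)
  interpret ring_hom_ring free_ring S \<pi> by (rule assms)
  show "ring (ring_of_type_algebra :: 'k ring)" by (rule ring_from_type_algebra)
  show "ring S" by (rule S.ring_axioms)
  show "\<pi> \<circ> scalar \<in> ring_hom ring_of_type_algebra S"
    using hom_add hom_mult hom_one
    by (intro ring_hom_memI) (simp_all add: ring_of_type_algebra_def scalar_mult)
qed

text \<open>
  The quotient enters through a surjection \<open>\<pi>\<close> with kernel \<open>J\<close> rather than as a ring of cosets, so that
  the one-step quotient \<open>A\<close> and the two-step quotient \<open>B\<close> are covered alike. \<open>Q_gen_u\<close> and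
  \<open>J_annihilating\<close> bound \<open>J\<close> from below and from above; \<open>proper\<close> ensures that the ground field
  embeds into the quotient.
\<close>

locale skew_quotient = skew_ideal J e + hom: ring_hom_ring free_ring S \<pi>
  for J :: "'k::field free_alg set" and e and S :: "'s ring" and \<pi> +
  fixes Q :: "'k poly"
  assumes surj: "carrier S = range \<pi>"
    and kernel: "\<pi> f = \<zero>\<^bsub>S\<^esub> \<longleftrightarrow> f \<in> J"
    and Q_gen_u: "at_y Q * gen_u \<in> J"
    and J_annihilating: "J \<subseteq> annihilating e Q"
    and proper: "\<not> Q * e dvd 1"
begin

abbreviation K where "K \<equiv> range (\<lambda>k. \<pi> (scalar k))"

text \<open>
  One direction applies the action to \<open>(1, 0)\<close>. The other writes \<open>Qe\<close> as \<open>Q u u\<close> modulo \<open>J\<close>.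
\<close>
lemma normal_form_mem_iff: "at_y p + at_y q * gen_u \<in> J \<longleftrightarrow> Q * e dvd p \<and> Q dvd q"
proof
  assume "at_y p + at_y q * gen_u \<in> J"
  then have "act e (at_y p + at_y q * gen_u) (1, 0) \<in> submodule_pairs e Q"
    using J_annihilating by (auto simp: annihilating_def)
  then show "Q * e dvd p \<and> Q dvd q"
    by (simp add: act_add act_mult act_gen_u[OF two] submodule_pairs_def plus_prod_def pcompose_1)
next
  assume "Q * e dvd p \<and> Q dvd q"
  then obtain r s where rs: "p = Q * e * r" "q = Q * s" by (auto elim!: dvdE)
  have "at_y (r * Q) * at_y e \<approx> at_y (r * Q) * (gen_u * gen_u)"
    using gen_u_square eqv_left eqv_sym by blast
  also have "\<dots> = at_y r * ((at_y Q * gen_u) * gen_u)"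
    by (simp add: poly_at_mult mult.assoc)
  finally have "at_y p \<in> J"
    using mult_left[OF mult_right[OF Q_gen_u]] eqv_mem
    by (simp add: rs ac_simps flip: poly_at_mult)
  moreover have "at_y q * gen_u = at_y s * (at_y Q * gen_u)"
    by (simp add: rs mult.commute[of Q s] poly_at_mult mult.assoc)
  then have "at_y q * gen_u \<in> J"
    using mult_left[OF Q_gen_u] by metis
  ultimately show "at_y p + at_y q * gen_u \<in> J" by (rule add)
qed

lemma subfield_K: "subfield K S"
proof -
  have "1 \<notin> J"
    using normal_form_mem_iff[of 1 0] proper by (simp add: one_pCons poly_at_pCons)
  then have "\<one>\<^bsub>S\<^esub> \<noteq> \<zero>\<^bsub>S\<^esub>"
    using kernel[of 1] hom.hom_one by simp
  moreover have "subfield (carrier ring_of_type_algebra) (ring_of_type_algebra :: 'k ring)"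
    by (rule field.carrier_is_subfield[OF field_from_type_algebra])
  ultimately have "subfield ((\<pi> \<circ> scalar) ` carrier ring_of_type_algebra) S"
    using ring_hom_ring.img_is_subfield(2)[OF scalar_hom[OF hom.ring_hom_ring_axioms]] by blast
  then show ?thesis by (simp add: ring_of_type_algebra_def image_comp comp_def)
qed

lemma combine_image:
  "hom.S.combine (map (\<lambda>i. \<pi> (scalar (k i))) is) (map (\<lambda>i. \<pi> (v i)) is)
    = \<pi> (\<Sum>i\<leftarrow>is. scalar (k i) * v i)"
proof (induction "is")
  case Nil
  then show ?case using kernel[of 0] zero by simp
next
  case (Cons i "is")
  then show ?case
    using hom.hom_add[of "scalar (k i) * v i" "\<Sum>i\<leftarrow>is. scalar (k i) * v i"]
      hom.hom_mult[of "scalar (k i)" "v i"] by simp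
qed

definition normal_monomial :: "nat \<Rightarrow> nat \<Rightarrow> 'k free_alg"
  where "normal_monomial M i = (if i < M then gen_y ^ i else gen_y ^ (i - M) * gen_u)"

definition monomials :: "nat \<Rightarrow> nat \<Rightarrow> 's list"
  where "monomials M N = map (\<lambda>i. \<pi> (normal_monomial M i)) [0..<M + N]"

lemma sum_normal_monomials:
  "(\<Sum>i\<leftarrow>[0..<M + N]. scalar (k i) * normal_monomial M i)
    = at_y (\<Sum>i<M. Polynomial.monom (k i) i) + at_y (\<Sum>i<N. Polynomial.monom (k (M + i)) i) * gen_u"
proof (induction N)
  case 0
  have "(\<Sum>i\<leftarrow>[0..<M]. scalar (k i) * normal_monomial M i) = (\<Sum>i<M. scalar (k i) * gen_y ^ i)"
    by (simp add: sum_list_distinct_conv_sum_set atLeast0LessThan normal_monomial_def)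
  then show ?case by (simp add: poly_at_sum poly_at_monom)
next
  case (Suc N)
  then show ?case
    by (simp add: normal_monomial_def poly_at_add poly_at_monom distrib_right mult.assoc add.assoc)
qed

lemma set_monomials: "set (monomials M N) \<subseteq> carrier S"
  by (auto simp: monomials_def surj)

lemma coefficients_in_K:
  assumes "set Ks \<subseteq> K" "length Ks = L"
  obtains k where "Ks = map (\<lambda>i. \<pi> (scalar (k i))) [0..<L]"
proof -
  have "\<exists>a. Ks ! i = \<pi> (scalar a)" if "i < L" for i
    using assms that nth_mem by fastforce
  then obtain k where "\<And>i. i < L \<Longrightarrow> Ks ! i = \<pi> (scalar (k i))" by metis
  then have "Ks = map (\<lambda>i. \<pi> (scalar (k i))) [0..<L]"
    using assms by (intro nth_equalityI) simp_all
  then show ?thesis by (rule that)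
qed

text \<open>
  Allowing \<open>Q = 0\<close>, with no bound on \<open>M\<close> and \<open>N\<close>, makes this lemma serve the infinite dimensional case
  as well.
\<close>
lemma independent_monomials:
  assumes "Q * e = 0 \<or> M \<le> Polynomial.degree (Q * e)" "Q = 0 \<or> N \<le> Polynomial.degree Q"
  shows "hom.S.independent K (monomials M N)"
proof (rule ccontr)
  assume "\<not> hom.S.independent K (monomials M N)"
  then obtain Ks where Ks: "length Ks = length (monomials M N)"
    "hom.S.combine Ks (monomials M N) = \<zero>\<^bsub>S\<^esub>" "set Ks \<subseteq> K" "set Ks \<noteq> {\<zero>\<^bsub>S\<^esub>}"
    using hom.S.dependent_imp_non_trivial_combine[OF subfield_K set_monomials] by metis
  have len: "length (monomials M N) = M + N" by (simp add: monomials_def)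
  obtain k where k: "Ks = map (\<lambda>i. \<pi> (scalar (k i))) [0..<M + N]"
    using coefficients_in_K[OF Ks(3), of "M + N"] Ks(1) len by metis
  have "\<pi> (\<Sum>i\<leftarrow>[0..<M + N]. scalar (k i) * normal_monomial M i) = \<zero>\<^bsub>S\<^esub>"
    using Ks(2) combine_image[of k "[0..<M + N]" "normal_monomial M"] by (simp add: k monomials_def)
  then have dvd: "Q * e dvd (\<Sum>i<M. Polynomial.monom (k i) i)"
      "Q dvd (\<Sum>i<N. Polynomial.monom (k (M + i)) i)"
    by (simp_all only: kernel sum_normal_monomials normal_form_mem_iff)
  have "k i = 0" if "i < M + N" for i
    using dvd_sum_monom_zero[OF dvd(1) assms(1), of i]
      dvd_sum_monom_zero[OF dvd(2) assms(2), of "i - M"] that by (cases "i < M") simp_all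
  then have "set Ks \<subseteq> {\<zero>\<^bsub>S\<^esub>}"
    using kernel[of 0] zero by (auto simp: k)
  then have "M + N = 0"
    using Ks(1,4) len by (cases Ks) auto
  then show False
    using \<open>\<not> hom.S.independent K (monomials M N)\<close> by (simp add: monomials_def)
qed

lemma infinite_dimension_if_zero:
  assumes "Q * e = 0"
  shows "\<not> hom.S.finite_dimension K (carrier S)"
proof
  assume "hom.S.finite_dimension K (carrier S)"
  then obtain n where n: "hom.S.dimension n K (carrier S)" by auto
  have "length (monomials (Suc n) 0) \<le> n"
    by (rule hom.S.independent_length_le_dimension[OF subfield_K n])
      (use independent_monomials assms set_monomials in auto)
  then show False by (simp add: monomials_def)
qed

lemma dimension_quotient:
  assumes "Q * e \<noteq> 0"
  shows "hom.S.dimension (2 * Polynomial.degree Q + Polynomial.degree e) K (carrier S)"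
proof -
  define M where "M = Polynomial.degree (Q * e)"
  define N where "N = Polynomial.degree Q"
  have "hom.S.Span K (monomials M N) = carrier S"
  proof
    show "hom.S.Span K (monomials M N) \<subseteq> carrier S"
      by (rule hom.S.Span_in_carrier) (use subfield_K set_monomials subfieldE(3) in auto)
    show "carrier S \<subseteq> hom.S.Span K (monomials M N)"
    proof
      fix s assume "s \<in> carrier S"
      then obtain f where f: "s = \<pi> f" by (auto simp: surj)
      \<comment> \<open>Reduce to a normal form, then take remainders modulo \<open>Qe\<close> and \<open>Q\<close>.\<close>
      obtain p q where pq: "f \<approx> at_y p + at_y q * gen_u"
        using all_reducible reducible_def by blast
      obtain j where j: "Q * e dvd p - (\<Sum>i<M. Polynomial.monom (j i) i)"
        using exists_sum_monom assms unfolding M_def by blast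
      obtain k where k: "Q dvd q - (\<Sum>i<N. Polynomial.monom (k i) i)"
        using exists_sum_monom[of Q q] assms unfolding N_def by auto
      define l where "l i = (if i < M then j i else k (i - M))" for i
      let ?g = "\<Sum>i\<leftarrow>[0..<M + N]. scalar (l i) * normal_monomial M i"
      have "?g = at_y (\<Sum>i<M. Polynomial.monom (j i) i) + at_y (\<Sum>i<N. Polynomial.monom (k i) i) * gen_u"
        by (simp add: sum_normal_monomials l_def)
      then have "at_y p + at_y q * gen_u - ?g
          = at_y (p - (\<Sum>i<M. Polynomial.monom (j i) i)) + at_y (q - (\<Sum>i<N. Polynomial.monom (k i) i)) * gen_u"
        by (simp add: poly_at_diff algebra_simps)
      then have "at_y p + at_y q * gen_u \<approx> ?g"
        using j k by (simp add: eqv_def normal_form_mem_iff)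
      with pq have "f - ?g \<in> J" using eqv_trans eqv_def by blast
      then have "\<pi> (f - ?g) = \<zero>\<^bsub>S\<^esub>" using kernel by simp
      then have "\<pi> f = \<pi> ?g"
        using hom.hom_add[of "f - ?g" ?g] hom.hom_closed[of ?g] by simp
      then have "s = hom.S.combine (map (\<lambda>i. \<pi> (scalar (l i))) [0..<M + N]) (monomials M N)"
        by (simp add: f monomials_def combine_image)
      then show "s \<in> hom.S.Span K (monomials M N)"
        by (subst hom.S.Span_mem_iff_length_version[OF subfield_K set_monomials])
          (rule exI[of _ "map (\<lambda>i. \<pi> (scalar (l i))) [0..<M + N]"], auto simp: monomials_def)
    qed
  qed
  moreover have "hom.S.independent K (monomials M N)"
    by (rule independent_monomials) (simp_all add: M_def N_def)
  ultimately have "hom.S.dimension (length (monomials M N)) K (carrier S)"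
    using hom.S.dimensionI[OF subfield_K] by blast
  moreover have "length (monomials M N) = 2 * Polynomial.degree Q + Polynomial.degree e"
    using assms by (simp add: monomials_def M_def N_def degree_mult_eq)
  ultimately show ?thesis by simp
qed

end


section \<open>The relations of the potential algebra\<close>

text \<open>The polynomial \<open>e\<close> with \<open>u\<^sup>2 = e(y)\<close>.\<close>
definition square_poly :: "'k::field poly \<Rightarrow> 'k poly"
  where "square_poly b = Polynomial.monom 3 2 - Polynomial.smult 4 b"

lemma at_y_square_poly: "at_y (square_poly b) = 3 * gen_y ^ 2 - 4 * at_y b"
  by (simp add: square_poly_def poly_at_diff poly_at_monom poly_at_smult)

lemma relations_gen_u:
  "gen_u * gen_y + gen_y * gen_u
    = (2 :: 'k::field free_alg) * (gen_x * gen_y + gen_y * gen_x + gen_y ^ 2)"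
  "gen_u * gen_u - at_y (square_poly b)
    = (4 :: 'k::field free_alg) * (gen_x * gen_y + gen_y * gen_x + gen_x ^ 2 + at_y b)
      - 2 * (gen_x * gen_y + gen_y * gen_x + gen_y ^ 2)"
proof -
  show "gen_u * gen_y + gen_y * gen_u
    = (2 :: 'k free_alg) * (gen_x * gen_y + gen_y * gen_x + gen_y ^ 2)"
    by (simp add: gen_u_def algebra_simps power2_eq_square mult_2 mult_2_right)
  have four: "(4 :: 'k free_alg) * f = f + f + f + f" 
    and three: "(3 :: 'k free_alg) * f = f + f + f" for f
    using mult_2[of f] distrib_right[of 2 2 f] distrib_right[of 2 1 f] by (simp_all add: add.assoc)
  show "gen_u * gen_u - at_y (square_poly b)
    = (4 :: 'k free_alg) * (gen_x * gen_y + gen_y * gen_x + gen_x ^ 2 + at_y b)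
      - 2 * (gen_x * gen_y + gen_y * gen_x + gen_y ^ 2)"
    unfolding at_y_square_poly four three gen_u_def mult_2
    by (simp add: algebra_simps power2_eq_square)
qed

lemma commutator_gen_u:
  "gen_u * gen_y - gen_y * gen_u = (2 :: 'k::field free_alg) * (gen_x * gen_y - gen_y * gen_x)"
  by (simp add: gen_u_def algebra_simps mult_2 mult_2_right)

lemma (in free_ideal) cancel_numeral:
  assumes "(numeral n :: 'k) \<noteq> 0" "numeral n * f \<in> J"
  shows "f \<in> J"
proof -
  have "scalar (1 / numeral n) * (numeral n * f) = scalar (1 / numeral n * numeral n) * f"
    unfolding scalar_mult by (simp add: mult.assoc)
  also have "\<dots> = f" using assms(1) by simp
  finally show ?thesis using mult_left[OF assms(2)] by metis
qed

text \<open>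
  The change of generators from \<open>x\<close> to \<open>u\<close>. Recovering the original relations requires division
  by \<open>2\<close> and \<open>4\<close>.
\<close>
lemma (in free_ideal) relations_mem_iff:
  assumes two: "(2::'k) \<noteq> 0"
  shows "gen_x * gen_y + gen_y * gen_x + gen_y ^ 2 \<in> J
      \<and> gen_x * gen_y + gen_y * gen_x + gen_x ^ 2 + at_y b \<in> J
    \<longleftrightarrow> gen_u * gen_y + gen_y * gen_u \<in> J \<and> gen_u * gen_u - at_y (square_poly b) \<in> J"
    (is "?r \<in> J \<and> ?s \<in> J \<longleftrightarrow> _")
proof
  assume "?r \<in> J \<and> ?s \<in> J"
  then show "gen_u * gen_y + gen_y * gen_u \<in> J \<and> gen_u * gen_u - at_y (square_poly b) \<in> J"
    unfolding relations_gen_u by (blast intro: mult_left diff)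
next
  assume "gen_u * gen_y + gen_y * gen_u \<in> J \<and> gen_u * gen_u - at_y (square_poly b) \<in> J"
  then have r: "2 * ?r \<in> J" and s: "4 * ?s - 2 * ?r \<in> J"
    unfolding relations_gen_u by blast+
  have "(4::'k) = 2 * 2" by simp
  then have "(4::'k) \<noteq> 0" using two by (metis mult_eq_0_iff)
  moreover have "4 * ?s \<in> J" using add[OF s r] by simp
  ultimately show "?r \<in> J \<and> ?s \<in> J"
    using cancel_numeral two r by blast
qed

lemma annihilating_anti:
  assumes "(2::'k::field) \<noteq> 0"
  shows "gen_u * gen_y + gen_y * gen_u \<in> annihilating e (Q :: 'k poly)"
  by (auto simp: annihilating_def act_add act_mult act_gen_u[OF assms] refl_simps submodule_pairs_def)

text \<open>
  On the first component \<open>u\<^sup>2\<close> acts as \<open>e(y)\<close>, but on the second as \<open>e(-y)\<close>.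
\<close>
lemma annihilating_square:
  assumes "(2::'k::field) \<noteq> 0" "Q dvd refl_poly e - e"
  shows "gen_u * gen_u - at_y e \<in> annihilating e (Q :: 'k poly)"
proof -
  have "Q dvd q * refl_poly e - e * q" for q
    using dvd_mult[OF assms(2), of q] by (simp add: algebra_simps)
  then show ?thesis
    by (auto simp: annihilating_def act_diff act_mult act_gen_u[OF assms(1)] refl_simps submodule_pairs_def)
qed

lemma annihilating_commutator:
  assumes "(2::'k::field) \<noteq> 0"
  shows "gen_u * gen_y - gen_y * gen_u \<in> annihilating e [:0, 1 :: 'k:]"
proof -
  have dvd: "[:0, 1:] dvd pCons 0 (p :: 'k poly)" "[:0, 1:] * e dvd pCons 0 (p * e)" for p
    using dvd_triv_left[of "[:0, 1:]" p] dvd_triv_left[of "[:0, 1:] * e" p]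
    by (simp_all add: mult.commute)
  have "act e (gen_u * gen_y - gen_y * gen_u) (p, q)
      = (pCons 0 (- (refl_poly q + refl_poly q) * e), pCons 0 (- (refl_poly p + refl_poly p)))" for p q
    by (simp add: act_diff act_mult act_gen_u[OF assms] refl_simps algebra_simps)
  then show ?thesis
    unfolding annihilating_def submodule_pairs_def using dvd by (simp only: split_paired_All mem_Collect_eq fst_conv snd_conv) blast
qed

section \<open>The algebra and its abelianization as quotients\<close>

lemma quot_hom:
  assumes "ideal I R"
  shows "ring_hom_ring R (R Quot I) (a_r_coset R I)"
    and "carrier (R Quot I) = a_r_coset R I ` carrier R"
    and "f \<in> carrier R \<Longrightarrow> I +>\<^bsub>R\<^esub> f = \<zero>\<^bsub>R Quot I\<^esub> \<longleftrightarrow> f \<in> I"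
proof -
  interpret ideal I R by (rule assms)
  show "ring_hom_ring R (R Quot I) (a_r_coset R I)" by (rule rcos_ring_hom_ring)
  show "carrier (R Quot I) = a_r_coset R I ` carrier R"
    by (auto simp: FactRing_def A_RCOSETS_def')
  show "f \<in> carrier R \<Longrightarrow> I +>\<^bsub>R\<^esub> f = \<zero>\<^bsub>R Quot I\<^esub> \<longleftrightarrow> f \<in> I"
    using a_rcos_zero[OF assms] rcos_const_imp_mem by (auto simp: FactRing_def)
qed

lemma ideal_ideal_I: "ideal (ideal_I b) free_ring"
  unfolding ideal_I_def by (rule ring.genideal_ideal[OF ring_free_ring]) simp

lemma proj_A:
  "ring_hom_ring free_ring (alg_A b) (proj_A b)"
  "carrier (alg_A b) = range (proj_A b)"
  "proj_A b f = \<zero>\<^bsub>alg_A b\<^esub> \<longleftrightarrow> f \<in> ideal_I b"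
  using quot_hom[OF ideal_ideal_I[of b]] by (simp_all add: alg_A_def proj_A_def[abs_def])

lemma ideal_commutator_ideal: "ideal (commutator_ideal b) (alg_A b)"
proof -
  interpret ring_hom_ring free_ring "alg_A b" "proj_A b" by (rule proj_A(1))
  show ?thesis
    unfolding commutator_ideal_def by (rule S.genideal_ideal) (simp add: proj_A(2))
qed

text \<open>
  The kernel of the composite projection onto \<open>B\<close>, which is the ideal generated by the two relations
  and the commutator (see \<open>kernel_B_least\<close>).
\<close>
definition kernel_B :: "'k::field poly \<Rightarrow> 'k free_alg set"
  where "kernel_B b = {f. proj_A b f \<in> commutator_ideal b}"

lemma ideal_kernel_B: "ideal (kernel_B b) free_ring"
  using ring_hom_ring.ideal_vimage[OF proj_A(1) ideal_commutator_ideal, of b]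
  by (simp add: kernel_B_def)

lemma proj_B:
  "ring_hom_ring free_ring (alg_B b) (\<lambda>f. proj_B b (proj_A b f))"
  "carrier (alg_B b) = range (\<lambda>f. proj_B b (proj_A b f))"
  "proj_B b (proj_A b f) = \<zero>\<^bsub>alg_B b\<^esub> \<longleftrightarrow> f \<in> kernel_B b"
proof -
  note quot = quot_hom[OF ideal_commutator_ideal[of b], folded alg_B_def proj_B_def]
  interpret A: ring_hom_ring free_ring "alg_A b" "proj_A b" by (rule proj_A(1))
  interpret B: ring_hom_ring "alg_A b" "alg_B b" "proj_B b"
    using quot(1) by (simp add: proj_B_def[abs_def])
  show "ring_hom_ring free_ring (alg_B b) (\<lambda>f. proj_B b (proj_A b f))"
    using ring_hom_trans[OF A.homh B.homh] ring_free_ring B.S.ring_axioms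
    by (intro ring_hom_ringI2) (simp_all add: comp_def)
  show "carrier (alg_B b) = range (\<lambda>f. proj_B b (proj_A b f))"
    using quot(2) by (auto simp: proj_A(2) proj_B_def image_image)
  show "proj_B b (proj_A b f) = \<zero>\<^bsub>alg_B b\<^esub> \<longleftrightarrow> f \<in> kernel_B b"
    using quot(3)[of "proj_A b f"] by (simp add: proj_A(2) proj_B_def kernel_B_def)
qed

lemma ideal_I_subset_iff:
  assumes "(2::'k::field) \<noteq> 0" "ideal J free_ring"
  shows "ideal_I (b :: 'k poly) \<subseteq> J
    \<longleftrightarrow> gen_u * gen_y + gen_y * gen_u \<in> J \<and> gen_u * gen_u - at_y (square_poly b) \<in> J"
proof -
  interpret free_ideal J using assms(2) by (rule free_ideal.intro)
  interpret ring "free_ring :: 'k free_alg ring" by (rule ring_free_ring)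
  show ?thesis
    unfolding ideal_I_def relations_mem_iff[OF assms(1), symmetric]
    by (subst Idl_subset_ideal[OF assms(2)]) simp_all
qed

lemma ideal_I_subset_kernel_B: "ideal_I b \<subseteq> kernel_B b"
proof
  fix f assume "f \<in> ideal_I b"
  then have "proj_A b f = \<zero>\<^bsub>alg_A b\<^esub>" using proj_A(3) by blast
  then show "f \<in> kernel_B b"
    using additive_subgroup.zero_closed[OF ideal.axioms(1)[OF ideal_commutator_ideal]]
    by (simp add: kernel_B_def)
qed

lemma commutator_in_kernel_B: "gen_x * gen_y - gen_y * gen_x \<in> kernel_B b"
proof -
  interpret ring_hom_ring free_ring "alg_A b" "proj_A b" by (rule proj_A(1))
  show ?thesis
    unfolding kernel_B_def commutator_ideal_def
    using S.genideal_self[of "{proj_A b (gen_x * gen_y - gen_y * gen_x)}"] by (simp add: proj_A(2))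
qed

lemma kernel_B_least:
  assumes "ideal J free_ring" "ideal_I b \<subseteq> J" "gen_x * gen_y - gen_y * gen_x \<in> J"
  shows "kernel_B b \<subseteq> J"
proof
  interpret free_ideal J using assms(1) by (rule free_ideal.intro)
  interpret hom: ring_hom_ring free_ring "alg_A b" "proj_A b" by (rule proj_A(1))
  have "ideal (proj_A b ` J) (alg_A b)"
    using ring.ring_ideal_imp_quot_ideal[OF ring_free_ring ideal_ideal_I assms(1), of b]
    by (simp add: alg_A_def proj_A_def[abs_def])
  then have sub: "commutator_ideal b \<subseteq> proj_A b ` J"
    unfolding commutator_ideal_def using assms(3) by (intro hom.S.genideal_minimal) simp_all
  fix f assume "f \<in> kernel_B b"
  then obtain g where g: "g \<in> J" "proj_A b f = proj_A b g"
    using sub by (auto simp: kernel_B_def)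
  have "proj_A b (f - g) \<oplus>\<^bsub>alg_A b\<^esub> proj_A b g = proj_A b g"
    using hom.hom_add[of "f - g" g] g(2) by simp
  then have "proj_A b (f - g) = \<zero>\<^bsub>alg_A b\<^esub>"
    using hom.hom_closed[of g] hom.hom_closed[of "f - g"] by simp
  then have "f - g \<in> J" using proj_A(3) assms(2) by blast
  then show "f \<in> J" using add[OF _ g(1)] by fastforce
qed

lemma refl_square_poly:
  "refl_poly (square_poly b) - square_poly b = Polynomial.smult 4 (b - refl_poly b)"
  by (simp add: square_poly_def refl_simps monom_altdef pcompose_pCons power2_eq_square smult_diff_right)

section \<open>Dimensions of the algebra and of its abelianization\<close>

locale potential =
  fixes b c :: "'k::field poly"
  assumes two: "(2::'k) \<noteq> 0"
    and c_def: "c = Polynomial.smult (1/2) (b - refl_poly b)"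
    and degree_b: "Polynomial.degree b \<ge> 3"
begin

lemma refl_c: "refl_poly c = - c"
  by (simp add: c_def refl_simps flip: smult_minus_right)

lemma b_minus_refl: "b - refl_poly b = Polynomial.smult 2 c"
  using two by (simp add: c_def)

lemma refl_square_poly_c: "refl_poly (square_poly b) - square_poly b = Polynomial.smult 8 c"
  by (simp add: refl_square_poly b_minus_refl)

lemma y_dvd_c: "[:0, 1:] dvd c"
  using poly_eq_0_iff_dvd[of c 0] by (simp add: c_def poly_pcompose)

lemma numerals: "(4::'k) \<noteq> 0" "(8::'k) \<noteq> 0"
proof -
  have "(4::'k) = 2 * 2" "(8::'k) = 2 * 2 * 2" by simp_all
  then show "(4::'k) \<noteq> 0" "(8::'k) \<noteq> 0" using two by (metis mult_eq_0_iff)+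
qed

text \<open>
  The bound on the degree of \<open>b\<close>, which is the hypothesis \<open>n > 3\<close>, lets \<open>4b\<close> dominate \<open>3y\<^sup>2\<close>.
\<close>
lemma degree_square_poly: "Polynomial.degree (square_poly b) = Polynomial.degree b"
proof -
  have "Polynomial.degree (Polynomial.monom (3::'k) 2) \<le> 2" by (rule degree_monom_le)
  then have "Polynomial.degree (Polynomial.monom (3::'k) 2) < Polynomial.degree (- Polynomial.smult 4 b)"
    using degree_b numerals by simp
  then show ?thesis
    using degree_add_eq_right[of "Polynomial.monom (3::'k) 2" "- Polynomial.smult 4 b"] numerals
    by (simp add: square_poly_def)
qed

lemma square_poly_nonzero: "square_poly b \<noteq> 0"
  using degree_square_poly degree_b by auto

lemma not_unit: "\<not> Q * square_poly b dvd 1"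
proof
  assume dvd: "Q * square_poly b dvd 1"
  then have "Q \<noteq> 0" by auto
  then show False
    using dvd_imp_degree_le[OF dvd] degree_b square_poly_nonzero
    by (simp add: degree_mult_eq degree_square_poly)
qed

sublocale A: skew_quotient "ideal_I b" "square_poly b" "alg_A b" "proj_A b" c
proof -
  note I = ideal_I_subset_iff[OF two ideal_ideal_I[of b], of b, simplified]
  interpret skew_ideal "ideal_I b" "square_poly b"
    using I two ideal_ideal_I by (intro skew_ideal.intro free_ideal.intro skew_ideal_axioms.intro) auto
  have "ideal (annihilating (square_poly b) c) free_ring"
    by (rule ideal_annihilating) (simp add: refl_c)
  then have "ideal_I b \<subseteq> annihilating (square_poly b) c"
    using ideal_I_subset_iff[OF two] annihilating_anti[OF two] annihilating_square[OF two]
    by (simp add: refl_square_poly_c dvd_smult)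
  moreover have "8 * (at_y c * gen_u) \<in> ideal_I b"
    using reflection_difference
    by (simp add: refl_square_poly_c poly_at_smult mult.assoc)
  then have "at_y c * gen_u \<in> ideal_I b"
    using cancel_numeral numerals by blast
  ultimately show "skew_quotient (ideal_I b) (square_poly b) (alg_A b) (proj_A b) c"
    using proj_A[of b] not_unit skew_ideal_axioms
    by (auto simp: skew_quotient_def skew_quotient_axioms_def)
qed

text \<open>
  For \<open>B\<close> the role of \<open>c\<close> is played by \<open>y\<close>: the difference of \<open>uy + yu\<close> and \<open>uy - yu\<close> is
  \<open>2yu\<close>. As \<open>y\<close> divides \<open>c\<close>, the defining relations still act into the submodule.
\<close>
sublocale B: skew_quotient "kernel_B b" "square_poly b" "alg_B b" "\<lambda>f. proj_B b (proj_A b f)" "[:0, 1:]"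
proof -
  interpret free_ideal "kernel_B b" by (rule free_ideal.intro[OF ideal_kernel_B])
  have rels: "gen_u * gen_y + gen_y * gen_u \<in> kernel_B b"
      "gen_u * gen_u - at_y (square_poly b) \<in> kernel_B b"
    using ideal_I_subset_iff[OF two ideal_kernel_B] ideal_I_subset_kernel_B by blast+
  interpret skew_ideal "kernel_B b" "square_poly b"
    using rels two by (intro skew_ideal.intro free_ideal_axioms skew_ideal_axioms.intro) auto
  have ann: "ideal (annihilating (square_poly b) [:0, 1:]) free_ring"
    by (rule ideal_annihilating, subst dvd_minus_iff[symmetric]) (simp add: pcompose_pCons)
  interpret ann: free_ideal "annihilating (square_poly b) [:0, 1:]"
    by (rule free_ideal.intro[OF ann])
  have "ideal_I b \<subseteq> annihilating (square_poly b) [:0, 1:]"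
    using ideal_I_subset_iff[OF two ann] annihilating_anti[OF two] annihilating_square[OF two] y_dvd_c
    by (simp add: refl_square_poly_c dvd_smult)
  moreover have "gen_x * gen_y - gen_y * gen_x \<in> annihilating (square_poly b) [:0, 1:]"
    using annihilating_commutator[OF two] two unfolding commutator_gen_u
    by (rule ann.cancel_numeral[rotated])
  ultimately have "kernel_B b \<subseteq> annihilating (square_poly b) [:0, 1:]"
    by (rule kernel_B_least[OF ann])
  moreover have "2 * (gen_y * gen_u) \<in> kernel_B b"
  proof -
    have "gen_u * gen_y - gen_y * gen_u \<in> kernel_B b"
      unfolding commutator_gen_u by (rule mult_left[OF commutator_in_kernel_B])
    with rels(1) have "(gen_u * gen_y + gen_y * gen_u) - (gen_u * gen_y - gen_y * gen_u) \<in> kernel_B b"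
      by (rule diff)
    then show ?thesis by (simp add: mult_2)
  qed
  then have "at_y [:0, 1:] * gen_u \<in> kernel_B b"
    using cancel_numeral two by (simp add: at_y_gen)
  ultimately show "skew_quotient (kernel_B b) (square_poly b) (alg_B b)
      (\<lambda>f. proj_B b (proj_A b f)) [:0, 1:]"
    using proj_B[of b] not_unit[of "[:0, 1:]"] skew_ideal_axioms
    unfolding skew_quotient_def skew_quotient_axioms_def by blast
qed

lemma dim_A:
  assumes "c \<noteq> 0"
  shows "finite_dim_A b" "dim_A b = 2 * Polynomial.degree c + Polynomial.degree b"
proof -
  have "A.hom.S.dimension (2 * Polynomial.degree c + Polynomial.degree b) (scalars_A b) (carrier (alg_A b))"
    using A.dimension_quotient assms square_poly_nonzero
    by (simp add: degree_square_poly scalars_A_def)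
  then show "finite_dim_A b" "dim_A b = 2 * Polynomial.degree c + Polynomial.degree b"
    using A.hom.S.dimI[OF A.subfield_K] A.hom.S.finite_dimensionI
    by (auto simp: over_def scalars_A_def)
qed

lemma infinite_dim_A:
  assumes "c = 0"
  shows "\<not> finite_dim_A b"
  using A.infinite_dimension_if_zero assms by (simp add: scalars_A_def)

lemma dim_B: "finite_dim_B b" "dim_B b = Polynomial.degree b + 2"
proof -
  have "B.hom.S.dimension (Polynomial.degree b + 2) (scalars_B b) (carrier (alg_B b))"
    using B.dimension_quotient square_poly_nonzero
    by (simp add: degree_square_poly scalars_B_def)
  then show "finite_dim_B b" "dim_B b = Polynomial.degree b + 2"
    using B.hom.S.dimI[OF B.subfield_K] B.hom.S.finite_dimensionI
    by (auto simp: over_def scalars_B_def)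
qed

text \<open>The leading coefficient of an odd polynomial of even degree would be its own negative.\<close>
lemma odd_degree_c:
  assumes "c \<noteq> 0"
  shows "odd (Polynomial.degree c)"
proof
  assume "even (Polynomial.degree c)"
  then have "lead_coeff c = - lead_coeff c"
    using arg_cong[OF refl_c, of "\<lambda>p. Polynomial.coeff p (Polynomial.degree c)"]
    by (simp add: coeff_pcompose_linear)
  then have "2 * lead_coeff c = 0" by (simp only: mult_2 eq_neg_iff_add_eq_0)
  then show False using two assms by simp
qed

lemma dim_difference:
  assumes "c \<noteq> 0"
  shows "4 dvd int (dim_A b) - int (dim_B b)"
proof -
  obtain j where "Polynomial.degree c = 2 * j + 1"
    using odd_degree_c[OF assms] by (rule oddE)
  then have "int (dim_A b) - int (dim_B b) = 4 * int j"
    by (simp add: dim_A[OF assms] dim_B)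
  then show ?thesis by simp
qed

end

lemma two_nonzero_if_CHAR:
  assumes "CHAR('k::field) \<noteq> 2"
  shows "(2::'k) \<noteq> 0"
proof
  assume "(2::'k) = 0"
  then have "of_nat 2 = (0::'k)" unfolding of_nat_numeral .
  then have "CHAR('k) dvd 2"
    unfolding of_nat_eq_0_iff_char_dvd .
  moreover have "CHAR('k) \<noteq> 1"
    using CHAR_not_1'[where 'a = 'k] by simp
  ultimately show False
    using assms two_is_prime_nat unfolding prime_nat_iff by blast
qed

lemma pCons_0_sum: "pCons 0 (\<Sum>j\<in>S. p j) = (\<Sum>j\<in>S. pCons 0 (p j))"
proof (induction S rule: infinite_finite_induct)
  case (insert x F)
  have "pCons 0 (p x + sum p F) = pCons 0 (p x) + pCons 0 (sum p F)" by simp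
  then show ?case using insert by simp
qed simp_all

theorem claim2:
  fixes n :: nat and \<alpha> :: "nat \<Rightarrow> 'k::field" and a b c d :: "'k poly"
  assumes "CHAR('k) \<noteq> 2"
    and "n > 3"
    and "a = (\<Sum>j=3..n. Polynomial.monom (\<alpha> j) j)"
    and "\<alpha> n \<noteq> 0"
    and "b = (\<Sum>j=3..n. Polynomial.monom (\<alpha> j) (j - 1))"
    and "c = Polynomial.smult (1/2) (b - pcompose b [:0, -1:])"
    and "d = Polynomial.smult (1/2) (b + pcompose b [:0, -1:])"
  shows "(\<not> finite_dim_A b \<longleftrightarrow> c = 0) \<and> (c = 0 \<longleftrightarrow> pcompose a [:0, -1:] = - a)
    \<and> Polynomial.degree b = n - 1
    \<and> (\<forall>m. c \<noteq> 0 \<and> m = Polynomial.degree c \<and> m < n - 1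
          \<longrightarrow> finite_dim_A b \<and> dim_A b = n + 2 * m - 1)
    \<and> (c \<noteq> 0 \<and> Polynomial.degree c = Polynomial.degree b
          \<longrightarrow> finite_dim_A b \<and> dim_A b = 3 * n - 3)
    \<and> (finite_dim_A b
          \<longrightarrow> finite_dim_B b \<and> (4::int) dvd int (dim_A b) - int (dim_B b))"
proof -
  have degree_eq: "Polynomial.degree b = n - 1"
  proof (rule antisym)
    show "Polynomial.degree b \<le> n - 1"
      unfolding assms(5) by (rule degree_sum_le) (auto intro: order.trans[OF degree_monom_le])
    have "Polynomial.coeff b (n - 1) = (\<Sum>j=3..n. if j = n then \<alpha> n else 0)"
      unfolding assms(5) coeff_sum by (rule sum.cong) auto
    then have "Polynomial.coeff b (n - 1) = \<alpha> n"
      using assms(2) by simp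
    then show "n - 1 \<le> Polynomial.degree b"
      using assms(4) by (intro le_degree) simp
  qed
  have "Polynomial.monom (\<alpha> j) j = pCons 0 (Polynomial.monom (\<alpha> j) (j - 1))" if "j \<in> {3..n}" for j
    using that by (simp flip: monom_Suc)
  then have "(\<Sum>j=3..n. Polynomial.monom (\<alpha> j) j) = (\<Sum>j=3..n. pCons 0 (Polynomial.monom (\<alpha> j) (j - 1)))"
    by (meson sum.cong)
  then have a: "a = pCons 0 b"
    unfolding assms(3,5) pCons_0_sum .
  have two: "(2::'k) \<noteq> 0"
    by (rule two_nonzero_if_CHAR) (rule assms(1))
  interpret potential b c
    by (rule potential.intro) (use two degree_eq assms(2) in \<open>simp_all add: assms(6)\<close>)
  have "c = 0 \<longleftrightarrow> refl_poly b = b"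
    using two by (auto simp: c_def)
  also have "\<dots> \<longleftrightarrow> refl_poly a = - a"
    by (simp add: a refl_simps)
  finally have odd_iff: "c = 0 \<longleftrightarrow> refl_poly a = - a" .
  have A: "finite_dim_A b" "dim_A b = n - 1 + 2 * Polynomial.degree c" if "c \<noteq> 0"
    using dim_A[OF that] by (simp_all only: degree_eq add.commute)
  show ?thesis
  proof (intro conjI allI impI)
    show "\<not> finite_dim_A b \<longleftrightarrow> c = 0"
      using A(1) infinite_dim_A by blast
    show "c = 0 \<longleftrightarrow> refl_poly a = - a" by (rule odd_iff)
    show "Polynomial.degree b = n - 1" by (rule degree_eq)
  next
    fix m assume m: "c \<noteq> 0 \<and> m = Polynomial.degree c \<and> m < n - 1"
    then show "finite_dim_A b" using A(1) by blast
    show "dim_A b = n + 2 * m - 1" using m A(2) assms(2) by force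
  next
    assume c: "c \<noteq> 0 \<and> Polynomial.degree c = Polynomial.degree b"
    then show "finite_dim_A b" using A(1) by blast
    have "dim_A b = n - 1 + 2 * (n - 1)" using A(2) c degree_eq by metis
    then show "dim_A b = 3 * n - 3" by simp
  next
    assume "finite_dim_A b"
    then have "c \<noteq> 0" using infinite_dim_A by blast
    then show "4 dvd int (dim_A b) - int (dim_B b)" by (rule dim_difference)
    show "finite_dim_B b" by (rule dim_B(1))
  qed
qed

end
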